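(* Let $\mathcal{P}$ be a finite index set, $\{A_p : p\in\mathcal{P}\}$ a collection of real $n\times n$ matrices, each either stable or unstable, and $\mathcal{I}=\{I_q : q\in\mathcal{Q}\}$ a compact set of real $n\times n$ matrices. Suppose there exist a collection of symmetric positive definite matrices $\{Q_p\in M_n(\mathbb{R}) : p\in\mathcal{P}\}$ and constants $\lambda_p>0$ for $p\in\mathfrak{s}$, $\mu_p>0$ for $p\in\mathfrak{u}$, and $\gamma_{(p,q)}\ge1$ for $p,q\in\mathcal{P}$ satisfying $$Q_pA_p+A_p^\top Q_p\le-\lambda_pQ_p\ \text{ for all }p\in\mathfrak{s},\qquad Q_pA_p+A_p^\top Q_p\le\mu_pQ_p\ \text{ for all }p\in\mathfrak{u},$$ $$M^\top Q_pM\le\gamma_{(q,p)}Q_q\ \text{ for all }p,q\in\mathcal{P}\text{ and }M\in\mathcal{I}.$$ Let $\gamma=\max_{p,q\in\mathcal{P}}\gamma_{(p,q)}$, and let $\{\tau_p\}_{p\in\mathfrak{s}}$, $\{\eta_p\}_{p\in\mathfrak{u}}$ be positive constants. Then the impulsive switched system $\dot x(t)=A_{\sigma(t)}x(t)$, $x(t_k)=I_{\omega(t_k)}\,x(t_k^-)$ ($k\ge1$) is stable under arbitrary impulses (i.e. stable for every function $\omega:\{t_1,t_2,\dots\}\to\mathcal{Q}$) for any signal $\sigma\in\mathcal{S}^{M}\left(\{\tau_p\}_{p\in\mathfrak{s}},\{\eta_p\}_{p\in\mathfrak{u}}\right)$ satisfying $$\limsup_{t\to\infty}\left(-\sum_{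p\in\mathfrak{s}}\lambda_p\,N_s^p(0,t)\,\tau_p+\sum_{p\in\mathfrak{u}}\mu_p\,N_u^p(0,t)\,\eta_p+N(0,t)\ln\gamma\right)<0.$$
   Context: A real matrix is called stable if all its eigenvalues have negative real part, and unstable if at least one eigenvalue has positive real part; $\mathfrak{s},\mathfrak{u}\subseteq\mathcal{P}$ are the sets of indices $p$ with $A_p$ stable, resp. unstable. For symmetric matrices, $\le$ denotes the Loewner order. A switching signal is a right-continuous piecewise constant function $\sigma:[0,\infty)\to\mathcal{P}$ whose set of discontinuities $\{t_k\}_{k\ge1}$ (switching times) is an increasing sequence with $t_k\uparrow\infty$; put $t_0=0$. $\mathcal{S}^{M}(\{\tau_p\}_{p\in\mathfrak{s}},\{\eta_p\}_{p\in\mathfrak{u}})$ is the set of switching signals such that for all $k\ge0$: $t_{k+1}-t_k\ge\tau_{\sigma(t_k)}$ if $\sigma(t_k)\in\mathfrak{s}$, and $t_{k+1}-t_k\le\eta_{\sigma(t_k)}$ if $\sigma(t_k)\in\mathfrak{u}$. For $p\in\mathfrak{s}$, $N_s^p(0,t)=\#\{i : 0\le t_i<t,\ \sigma(t_i)=p\}$; for $p\in\mathfrak{u}$, $N_u^p(0,t)=\#\{i : 0\le t_i<t,\ \sigma(t_i)=p\}$; and $N(0,t)=\sum_{p\in\mathfrak{s}}N_s^p(0,t)+\sum_{p\in\mathfrak{u}}N_u^p(0,t)$. In the impulsive switched system, $\dot x=A_{\sigma(t)}x$ holds on each $[t_{k-1},t_k)$ and $x(t_k^-)=\lim_{t\to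 t_k^-}x(t)$. The system (for fixed $\sigma,\omega$) is stable if for every $\epsilon>0$ there is $\delta>0$ such that $\|x(0)\|<\delta$ implies $\|x(t)\|<\epsilon$ for all $t>0$ (Euclidean norm). *)

theory Defs
  imports "HOL-Analysis.Analysis"
begin

section \<open>Stable and unstable matrices, Loewner order\<close>

text \<open>Eigenvalues of a real matrix are taken over the complex numbers.\<close>

definition complex_eigenvalue :: "real^'n^'n \<Rightarrow> complex \<Rightarrow> bool" where
  "complex_eigenvalue A l \<longleftrightarrow>
     (\<exists>v :: complex^'n. v \<noteq> 0 \<and> (\<chi> i j. complex_of_real (A $ i $ j)) *v v = l *s v)"

definition stable_matrix :: "real^'n^'n \<Rightarrow> bool" where
  "stable_matrix A \<longleftrightarrow> (\<forall>l. complex_eigenvalue A l \<longrightarrow> Re l < 0)"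

definition unstable_matrix :: "real^'n^'n \<Rightarrow> bool" where
  "unstable_matrix A \<longleftrightarrow> (\<exists>l. complex_eigenvalue A l \<and> Re l > 0)"

definition stable_indices :: "'p set \<Rightarrow> ('p \<Rightarrow> real^'n^'n) \<Rightarrow> 'p set" where
  "stable_indices P A = {p \<in> P. stable_matrix (A p)}"

definition unstable_indices :: "'p set \<Rightarrow> ('p \<Rightarrow> real^'n^'n) \<Rightarrow> 'p set" where
  "unstable_indices P A = {p \<in> P. unstable_matrix (A p)}"

definition pos_def_matrix :: "real^'n^'n \<Rightarrow> bool" where
  "pos_def_matrix Q \<longleftrightarrow> transpose Q = Q \<and> (\<forall>x. x \<noteq> 0 \<longrightarrow> x \<bullet> (Q *v x) > 0)"

definition pos_semidef_matrix :: "real^'n^'n \<Rightarrow> bool" where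
  "pos_semidef_matrix Q \<longleftrightarrow> transpose Q = Q \<and> (\<forall>x. x \<bullet> (Q *v x) \<ge> 0)"

definition loewner_le :: "real^'n^'n \<Rightarrow> real^'n^'n \<Rightarrow> bool" where
  "loewner_le A B \<longleftrightarrow> pos_semidef_matrix (B - A)"


section \<open>Switching signals\<close>

text \<open>
  A signal is a function on all of \<open>real\<close> of which only the values on \<open>{0..}\<close> matter. The index
  set is finite and discrete, so \<open>\<sigma>\<close> is continuous at a point iff it is constant near that point.
\<close>

definition discontinuities :: "(real \<Rightarrow> 'p) \<Rightarrow> real set" where
  "discontinuities \<sigma> = {s. s > 0 \<and> \<not> (\<forall>\<^sub>F r in at s. \<sigma> r = \<sigma> s)}"

definition is_switching_times :: "(real \<Rightarrow> 'p) \<Rightarrow> (nat \<Rightarrow> real) \<Rightarrow> bool" where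
  "is_switching_times \<sigma> t \<longleftrightarrow>
     t 0 = 0 \<and> strict_mono t \<and> filterlim t at_top sequentially \<and> t ` {1..} = discontinuities \<sigma>"

definition switching_time :: "(real \<Rightarrow> 'p) \<Rightarrow> nat \<Rightarrow> real" where
  "switching_time \<sigma> = (THE t. is_switching_times \<sigma> t)"

definition switching_signal :: "'p set \<Rightarrow> (real \<Rightarrow> 'p) \<Rightarrow> bool" where
  "switching_signal P \<sigma> \<longleftrightarrow>
     (\<forall>s\<ge>0. \<sigma> s \<in> P) \<and>
     (\<forall>s\<ge>0. \<forall>\<^sub>F r in at_right s. \<sigma> r = \<sigma> s) \<and>
     (\<exists>t. is_switching_times \<sigma> t) \<and>
     (\<forall>k. \<forall>s\<in>{switching_time \<sigma> k..<switching_time \<sigma> (Suc k)}. \<sigma> s = \<sigma> (switching_time \<sigma> k))"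

text \<open>The next two facts show that \<open>switching_time\<close> is well defined.\<close>

lemma strict_mono_same_range_le:
  fixes f g :: "nat \<Rightarrow> real"
  assumes "strict_mono f" "strict_mono g" "range g \<subseteq> range f"
  shows "f n \<le> g n"
proof -
  have "\<forall>k. \<exists>m. g k = f m" using assms(3) by auto
  then obtain h where h: "\<And>k. g k = f (h k)" by metis
  have "strict_mono h"
    using assms(1,2) by (simp add: strict_mono_def h) (metis h linorder_neqE_nat order_less_asym order_less_irrefl)
  then have "n \<le> h n" by (rule strict_mono_imp_increasing)
  then show ?thesis using assms(1) h by (simp add: strict_mono_less_eq)
qed

lemma switching_time_eqI:
  assumes "is_switching_times \<sigma> t"
  shows "switching_time \<sigma> = t"
  unfolding switching_time_def
proof (rule the_equality[where P = "is_switching_times \<sigma>", OF assms])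
  have UN: "(UNIV :: nat set) = insert 0 {1..}" by auto
  have rng: "range u = insert 0 (discontinuities \<sigma>)" if "is_switching_times \<sigma> u" for u
    using that unfolding is_switching_times_def UN image_insert by simp
  fix u assume u: "is_switching_times \<sigma> u"
  have "range u = range t" using rng assms u by simp
  moreover have "strict_mono u" "strict_mono t"
    using assms u by (auto simp: is_switching_times_def)
  ultimately show "u = t"
    by (intro ext antisym) (auto intro!: strict_mono_same_range_le)
qed

text \<open>
  \<open>S\<close> and \<open>U\<close> are the index sets of the stable and the unstable subsystems, \<open>\<tau>\<close> gives the minimal
  dwell times and \<open>\<eta>\<close> the maximal flee times.
\<close>

definition mode_dependent_signals ::
  "'p set \<Rightarrow> 'p set \<Rightarrow> 'p set \<Rightarrow> ('p \<Rightarrow> real) \<Rightarrow> ('p \<Rightarrow> real) \<Rightarrow> (real \<Rightarrow> 'p) set" where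
  "mode_dependent_signals P S U \<tau> \<eta> = {\<sigma>. switching_signal P \<sigma> \<and>
     (\<forall>k. let t = switching_time \<sigma>; p = \<sigma> (t k) in
        (p \<in> S \<longrightarrow> t (Suc k) - t k \<ge> \<tau> p) \<and> (p \<in> U \<longrightarrow> t (Suc k) - t k \<le> \<eta> p))}"

definition mode_count :: "(real \<Rightarrow> 'p) \<Rightarrow> 'p \<Rightarrow> real \<Rightarrow> nat" where
  "mode_count \<sigma> p t =
     card {i. 0 \<le> switching_time \<sigma> i \<and> switching_time \<sigma> i < t \<and> \<sigma> (switching_time \<sigma> i) = p}"

definition total_count :: "'p set \<Rightarrow> 'p set \<Rightarrow> (real \<Rightarrow> 'p) \<Rightarrow> real \<Rightarrow> nat" where
  "total_count S U \<sigma> t = (\<Sum>p\<in>S. mode_count \<sigma> p t) + (\<Sum>p\<in>U. mode_count \<sigma> p t)"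


section \<open>Impulsive switched systems\<close>

definition impulsive_solution ::
  "('p \<Rightarrow> real^'n^'n) \<Rightarrow> ('q \<Rightarrow> real^'n^'n) \<Rightarrow> (real \<Rightarrow> 'p) \<Rightarrow> (real \<Rightarrow> 'q) \<Rightarrow> (real \<Rightarrow> real^'n) \<Rightarrow> bool" where
  "impulsive_solution A I \<sigma> \<omega> x \<longleftrightarrow> (let t = switching_time \<sigma> in
     (\<forall>k\<ge>1. \<forall>s\<in>{t (k - 1)..<t k}.
        (x has_vector_derivative A (\<sigma> s) *v x s) (at s within {t (k - 1)..<t k})) \<and>
     (\<forall>k\<ge>1. \<exists>xl. (x \<longlongrightarrow> xl) (at_left (t k)) \<and> x (t k) = I (\<omega> (t k)) *v xl))"

definition impulsive_system_stable ::
  "('p \<Rightarrow> real^'n^'n) \<Rightarrow> ('q \<Rightarrow> real^'n^'n) \<Rightarrow> (real \<Rightarrow> 'p) \<Rightarrow> (real \<Rightarrow> 'q) \<Rightarrow> bool" where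
  "impulsive_system_stable A I \<sigma> \<omega> \<longleftrightarrow>
     (\<forall>\<epsilon>>0. \<exists>\<delta>>0. \<forall>x. impulsive_solution A I \<sigma> \<omega> x \<longrightarrow> norm (x 0) < \<delta> \<longrightarrow>
        (\<forall>t>0. norm (x t) < \<epsilon>))"

text \<open>Only the values of \<open>\<omega>\<close> at the switching times are relevant.\<close>

definition stable_under_arbitrary_impulses ::
  "('p \<Rightarrow> real^'n^'n) \<Rightarrow> 'q set \<Rightarrow> ('q \<Rightarrow> real^'n^'n) \<Rightarrow> (real \<Rightarrow> 'p) \<Rightarrow> bool" where
  "stable_under_arbitrary_impulses A Qs I \<sigma> \<longleftrightarrow>
     (\<forall>\<omega>. (\<forall>k\<ge>1. \<omega> (switching_time \<sigma> k) \<in> Qs) \<longrightarrow> impulsive_system_stable A I \<sigma> \<omega>)"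

end

theory Submission
  imports Defs
begin

text \<open>
  Along a trajectory the multiple Lyapunov function \<open>x \<mapsto> x \<bullet> Q\<^sub>p x\<close> of the active mode \<open>p\<close> grows
  between two switches at most by the factor \<open>exp (-\<lambda>\<^sub>p \<tau>\<^sub>p)\<close> or \<open>exp (\<mu>\<^sub>p \<eta>\<^sub>p)\<close>, and at each impulse
  at most by \<open>\<gamma>\<close>. Hence its value at the \<open>k\<close>-th switching time is at most its initial value times
  the exponential of the expression in the \<open>limsup\<close> at \<open>t\<^sub>k\<close>. These exponents are eventually negative,
  hence bounded above, and between switches the growth is bounded uniformly since there are
  finitely many modes.
\<close>

section \<open>Quadratic forms and a Gronwall estimate\<close>

lemma loewner_le_quadratic_form:
  assumes "loewner_le A B"
  shows "x \<bullet> (A *v x) \<le> x \<bullet> (B *v x)"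
  using assms
  by (simp add: loewner_le_def pos_semidef_matrix_def matrix_vector_mult_diff_rdistrib inner_diff_right)

lemma inner_transpose_matrix_vector:
  fixes M :: "real^'n^'m"
  shows "x \<bullet> (transpose M *v y) = (M *v x) \<bullet> y"
  by (metis dot_lmul_matrix inner_commute transpose_matrix_vector)

lemma has_real_derivative_quadratic_form:
  fixes Q :: "real^'n^'n"
  assumes "(x has_vector_derivative A *v x s) (at s within T)"
  shows "((\<lambda>s. x s \<bullet> (Q *v x s)) has_real_derivative
           x s \<bullet> ((Q ** A + transpose A ** Q) *v x s)) (at s within T)"
proof -
  have "((\<lambda>s. x s \<bullet> (Q *v x s)) has_derivative
      (\<lambda>h. x s \<bullet> (Q *v (h *\<^sub>R (A *v x s))) + (h *\<^sub>R (A *v x s)) \<bullet> (Q *v x s))) (at s within T)"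
    using assms unfolding has_vector_derivative_def
    by (intro has_derivative_inner bounded_linear.has_derivative[OF matrix_vector_mul_bounded_linear])
  moreover have "x s \<bullet> (Q *v (h *\<^sub>R (A *v x s))) + (h *\<^sub>R (A *v x s)) \<bullet> (Q *v x s)
      = x s \<bullet> ((Q ** A + transpose A ** Q) *v x s) * h" for h
    by (simp add: matrix_vector_mult_add_rdistrib inner_add_right matrix_vector_mult_scaleR
        inner_transpose_matrix_vector algebra_simps
        del: transpose_matrix_vector flip: matrix_vector_mul_assoc)
  ultimately show ?thesis
    by (simp add: has_field_derivative_def)
qed

lemma tendsto_quadratic_form:
  fixes Q :: "real^'n^'n"
  assumes "(x \<longlongrightarrow> l) F"
  shows "((\<lambda>s. x s \<bullet> (Q *v x s)) \<longlongrightarrow> l \<bullet> (Q *v l)) F"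
  by (intro tendsto_inner assms bounded_linear.tendsto[OF matrix_vector_mul_bounded_linear])

text \<open>By compactness the form attains its minimum on the unit sphere; definiteness makes this
  minimum positive, and it serves as \<open>m\<close>. The upper constant comes from Cauchy-Schwarz
  and a bound on the operator norm of \<open>Q\<close>.\<close>

lemma pos_def_matrix_bounds:
  fixes Q :: "real^'n^'n"
  assumes "pos_def_matrix Q"
  obtains m M where "m > 0" "M > 0" "\<And>x. m * (norm x)\<^sup>2 \<le> x \<bullet> (Q *v x)"
    "\<And>x. x \<bullet> (Q *v x) \<le> M * (norm x)\<^sup>2"
proof -
  have "continuous_on (sphere 0 1) (\<lambda>x. x \<bullet> (Q *v x))"
    by (intro continuous_on_inner continuous_on_id
        linear_continuous_on[OF matrix_vector_mul_bounded_linear])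
  \<comment> \<open>A point of the sphere: the infimum is attained only on a nonempty compact
    set.\<close>
  moreover have "axis undefined 1 \<in> sphere (0::real^'n) 1" by simp
  ultimately obtain u :: "real^'n" where u: "u \<in> sphere 0 1"
    and le: "\<forall>y\<in>sphere 0 1. u \<bullet> (Q *v u) \<le> y \<bullet> (Q *v y)"
    using continuous_attains_inf[OF compact_sphere, of 0 1 "\<lambda>x. x \<bullet> (Q *v x)"] by blast
  have "u \<noteq> 0" using u by auto
  then have m: "u \<bullet> (Q *v u) > 0" using assms by (simp add: pos_def_matrix_def)
  have low: "u \<bullet> (Q *v u) * (norm x)\<^sup>2 \<le> x \<bullet> (Q *v x)" for x
  proof (cases "x = 0")
    case False
    have "u \<bullet> (Q *v u) \<le> (x /\<^sub>R norm x) \<bullet> (Q *v (x /\<^sub>R norm x))"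
      using False by (intro le[rule_format]) simp
    also have "\<dots> = (x \<bullet> (Q *v x)) / (norm x)\<^sup>2"
      by (simp add: matrix_vector_mult_scaleR power2_eq_square divide_simps)
    finally show ?thesis using False by (simp add: pos_le_divide_eq)
  qed simp
  obtain K where K: "K > 0" "\<And>x. norm (Q *v x) \<le> norm x * K"
    using bounded_linear.pos_bounded[OF matrix_vector_mul_bounded_linear[of Q]] by auto
  have up: "x \<bullet> (Q *v x) \<le> K * (norm x)\<^sup>2" for x
  proof -
    have "x \<bullet> (Q *v x) \<le> norm x * norm (Q *v x)" by (rule norm_cauchy_schwarz)
    also have "\<dots> \<le> norm x * (norm x * K)" by (intro mult_left_mono K) simp
    finally show ?thesis by (simp add: power2_eq_square mult_ac)
  qed
  show ?thesis using that[OF m K(1) low up] .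
qed

text \<open>Constants independent of the mode allow the norm at any time to be compared with the
  initial norm, whichever modes are active at the two times.\<close>

lemma pos_def_matrices_uniform_bounds:
  fixes Q :: "'p \<Rightarrow> real^'n^'n"
  assumes "finite P" "\<forall>p\<in>P. pos_def_matrix (Q p)"
  obtains m M where "m > 0" "M > 0" "\<And>p x. p \<in> P \<Longrightarrow> m * (norm x)\<^sup>2 \<le> x \<bullet> (Q p *v x)"
    "\<And>p x. p \<in> P \<Longrightarrow> x \<bullet> (Q p *v x) \<le> M * (norm x)\<^sup>2"
proof -
  have "\<forall>p\<in>P. \<exists>m M. m > 0 \<and> M > 0 \<and> (\<forall>x. m * (norm x)\<^sup>2 \<le> x \<bullet> (Q p *v x))
      \<and> (\<forall>x. x \<bullet> (Q p *v x) \<le> M * (norm x)\<^sup>2)"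
    using assms(2) pos_def_matrix_bounds by metis
  then obtain m M where mM: "\<And>p. p \<in> P \<Longrightarrow> m p > 0 \<and> M p > 0"
    "\<And>p x. p \<in> P \<Longrightarrow> m p * (norm x)\<^sup>2 \<le> x \<bullet> (Q p *v x)"
    "\<And>p x. p \<in> P \<Longrightarrow> x \<bullet> (Q p *v x) \<le> M p * (norm x)\<^sup>2"
    by metis
  \<comment> \<open>The extra element 1 keeps both sets nonempty when \<open>P\<close> is empty, and
    is positive like the other elements.\<close>
  let ?m = "Min (insert 1 (m ` P))" and ?M = "Max (insert 1 (M ` P))"
  have fin: "finite (insert 1 (m ` P))" "finite (insert 1 (M ` P))" using assms(1) by auto
  show ?thesis
  proof (rule that[of ?m ?M])
    show "?m > 0" using mM(1) fin by (subst Min_gr_iff) auto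
    show "?M > 0" using fin(2) by (subst Max_gr_iff) auto
  next
    fix p x assume p: "p \<in> P"
    have "?m \<le> m p" using p fin by (intro Min_le) auto
    then show "?m * (norm x)\<^sup>2 \<le> x \<bullet> (Q p *v x)"
      using mM(2)[OF p, of x] mult_right_mono[of ?m "m p" "(norm x)\<^sup>2"] by simp
    have "M p \<le> ?M" using p fin by (intro Max_ge) auto
    then show "x \<bullet> (Q p *v x) \<le> ?M * (norm x)\<^sup>2"
      using mM(3)[OF p, of x] mult_right_mono[of "M p" ?M "(norm x)\<^sup>2"] by simp
  qed
qed

text \<open>The function \<open>exp (- c * (r - a)) * v r\<close> has nonpositive derivative, so it
  never exceeds its initial value. The sign of \<open>c\<close> is free, which covers stable and
  unstable modes alike. The interval is open at \<open>b\<close>, where a trajectory may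
  jump.\<close>

lemma gronwall_linear:
  fixes v v' :: "real \<Rightarrow> real"
  assumes der: "\<And>r. r \<in> {a..<b} \<Longrightarrow> (v has_real_derivative v' r) (at r within {a..<b})"
    and le: "\<And>r. r \<in> {a..<b} \<Longrightarrow> v' r \<le> c * v r"
    and s: "s \<in> {a..<b}"
  shows "v s \<le> exp (c * (s - a)) * v a"
proof -
  let ?w = "\<lambda>r. exp (- c * (r - a)) * v r"
  have dw: "(?w has_real_derivative exp (- c * (r - a)) * (v' r - c * v r)) (at r within {a..<b})"
    if "r \<in> {a..<b}" for r
    by (auto intro!: derivative_eq_intros der[OF that] simp: algebra_simps)
  have "?w s \<le> ?w a"
  \<comment> \<open>At \<open>a\<close> the derivative is only one-sided; this rule asks for
    continuity on the closed interval and derivatives only inside.\<close>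
  proof (rule DERIV_nonpos_imp_decreasing_open[where f = ?w])
    show "a \<le> s" using s by simp
    show "continuous_on {a..s} ?w"
      using s by (intro continuous_on_subset[OF DERIV_continuous_on[OF dw]]) auto
    fix r assume r: "a < r" "r < s"
    then have rb: "r \<in> {a..<b}" and int: "r \<in> interior {a..<b}" using s by auto
    have "(?w has_real_derivative exp (- c * (r - a)) * (v' r - c * v r)) (at r)"
      using dw[OF rb] by (simp add: at_within_interior[OF int])
    then show "\<exists>y. (?w has_real_derivative y) (at r) \<and> y \<le> 0"
      using le[OF rb] by (intro exI conjI) (auto simp: mult_nonneg_nonpos)
  qed
  then have "exp (c * (s - a)) * ?w s \<le> exp (c * (s - a)) * v a"
    by (intro mult_left_mono) auto
  then show ?thesis by (simp add: mult.assoc[symmetric] exp_add[symmetric])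
qed

section \<open>Mode counts and the exponent at switching times\<close>

lemma sum_weighted_card_fibers:
  fixes f :: "'p \<Rightarrow> real" and m :: "nat \<Rightarrow> 'p"
  assumes "finite S"
  shows "(\<Sum>p\<in>S. f p * real (card {i. i < k \<and> m i = p})) = (\<Sum>i<k. if m i \<in> S then f (m i) else 0)"
proof -
  have "real (card {i. i < k \<and> m i = p}) = (\<Sum>i<k. if m i = p then 1 else 0)" for p
    using sum.inter_filter[of "{..<k}" "\<lambda>_. 1 :: real" "\<lambda>i. m i = p"] by simp
  then have "(\<Sum>p\<in>S. f p * real (card {i. i < k \<and> m i = p}))
      = (\<Sum>p\<in>S. \<Sum>i<k. if m i = p then f p else 0)"
    by (simp add: sum_distrib_left if_distrib cong: if_cong)
  \<comment> \<open>After the interchange, each \<open>i\<close> retains only the term with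
    \<open>p = m i\<close>.\<close>
  also have "\<dots> = (\<Sum>i<k. \<Sum>p\<in>S. if m i = p then f p else 0)" by (rule sum.swap)
  finally show ?thesis using assms by simp
qed

text \<open>The strict bound in \<open>mode_count\<close> leaves out \<open>t k\<close> itself, so
  exactly the modes of the \<open>k\<close> completed intervals are counted.\<close>

lemma mode_count_switching_time:
  assumes "is_switching_times \<sigma> t"
  shows "mode_count \<sigma> p (t k) = card {i. i < k \<and> \<sigma> (t i) = p}"
proof -
  have "0 \<le> t i \<and> t i < t k \<longleftrightarrow> i < k" for i
    using assms strict_mono_less_eq[of t 0 i] strict_mono_less[of t i k]
    by (auto simp: is_switching_times_def)
  then have "{i. 0 \<le> t i \<and> t i < t k \<and> \<sigma> (t i) = p} = {i. i < k \<and> \<sigma> (t i) = p}" by blast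
  then show ?thesis by (simp add: mode_count_def switching_time_eqI[OF assms])
qed

text \<open>Regrouping by interval instead of by mode gives one summand for each completed interval,
  to be matched with the growth over that interval and the impulse ending it. As \<open>S\<close>
  and \<open>U\<close> are disjoint and cover all modes met, each interval contributes
  \<open>L\<close> exactly once.\<close>

lemma limsup_exponent_at_switching_times:
  fixes lam mu \<tau> \<eta> :: "'p \<Rightarrow> real" and L :: real
  assumes t: "is_switching_times \<sigma> t" and fin: "finite S" "finite U" and disj: "S \<inter> U = {}"
    and range: "\<And>i. \<sigma> (t i) \<in> S \<union> U"
  shows "- (\<Sum>p\<in>S. lam p * real (mode_count \<sigma> p (t k)) * \<tau> p)
           + (\<Sum>p\<in>U. mu p * real (mode_count \<sigma> p (t k)) * \<eta> p)
           + real (total_count S U \<sigma> (t k)) * L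
         = (\<Sum>i<k. (if \<sigma> (t i) \<in> S then - lam (\<sigma> (t i)) * \<tau> (\<sigma> (t i)) else mu (\<sigma> (t i)) * \<eta> (\<sigma> (t i))) + L)"
proof -
  let ?m = "\<lambda>i. \<sigma> (t i)"
  have S: "(\<Sum>p\<in>S. lam p * real (mode_count \<sigma> p (t k)) * \<tau> p)
      = (\<Sum>i<k. if ?m i \<in> S then lam (?m i) * \<tau> (?m i) else 0)"
    using sum_weighted_card_fibers[OF fin(1), of "\<lambda>p. lam p * \<tau> p" k ?m]
    by (simp add: mode_count_switching_time[OF t] mult_ac)
  have U: "(\<Sum>p\<in>U. mu p * real (mode_count \<sigma> p (t k)) * \<eta> p)
      = (\<Sum>i<k. if ?m i \<in> U then mu (?m i) * \<eta> (?m i) else 0)"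
    using sum_weighted_card_fibers[OF fin(2), of "\<lambda>p. mu p * \<eta> p" k ?m]
    by (simp add: mode_count_switching_time[OF t] mult_ac)
  have T: "real (total_count S U \<sigma> (t k)) * L
      = (\<Sum>i<k. (if ?m i \<in> S then L else 0) + (if ?m i \<in> U then L else 0))"
    using sum_weighted_card_fibers[OF fin(1), of "\<lambda>_. L" k ?m]
      sum_weighted_card_fibers[OF fin(2), of "\<lambda>_. L" k ?m]
    by (simp add: total_count_def mode_count_switching_time[OF t] sum.distrib algebra_simps
        flip: sum_distrib_left)
  show ?thesis
    unfolding S U T sum_negf[symmetric] sum.distrib[symmetric]
  proof (rule sum.cong)
    fix i show "- (if ?m i \<in> S then lam (?m i) * \<tau> (?m i) else 0) + (if ?m i \<in> U then mu (?m i) * \<eta> (?m i) else 0)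
        + ((if ?m i \<in> S then L else 0) + (if ?m i \<in> U then L else 0))
      = (if ?m i \<in> S then - lam (?m i) * \<tau> (?m i) else mu (?m i) * \<eta> (?m i)) + L"
      using range[of i] disj by auto
  qed simp
qed

lemma negative_Limsup_imp_bounded_above:
  fixes f :: "real \<Rightarrow> real"
  assumes "Limsup at_top (\<lambda>t. ereal (f t)) < 0" "filterlim t at_top sequentially"
  obtains B where "\<And>k. f (t k) \<le> B"
proof -
  have "\<forall>\<^sub>F s in at_top. f s < 0"
    using Limsup_lessD[OF assms(1)] by simp
  then have "\<forall>\<^sub>F k in sequentially. f (t k) < 0"
    using assms(2) by (rule eventually_compose_filterlim)
  then obtain N where N: "\<And>k. k \<ge> N \<Longrightarrow> f (t k) < 0"
    by (auto simp: eventually_sequentially)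
  \<comment> \<open>The maximum handles the finitely many early indices; the element 0 bounds the
    tail and keeps the set nonempty when \<open>N = 0\<close>.\<close>
  let ?B = "Max (insert 0 ((\<lambda>k. f (t k)) ` {..<N}))"
  have "f (t k) \<le> ?B" for k
  proof (cases "k < N")
    case True then show ?thesis by (intro Max_ge) auto
  next
    case False
    then have "f (t k) \<le> 0" using N[of k] by simp
    also have "0 \<le> ?B" by (intro Max_ge) auto
    finally show ?thesis .
  qed
  then show ?thesis by (rule that)
qed

lemma switching_interval_exists:
  assumes "is_switching_times \<sigma> t" "s \<ge> 0"
  obtains k where "t k \<le> s" "s < t (Suc k)"
proof -
  have "\<forall>\<^sub>F n in sequentially. s < t n"
    using assms(1) by (simp add: is_switching_times_def filterlim_at_top_dense)
  then have ex: "\<exists>n. s < t n" by (auto simp: eventually_sequentially)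
  \<comment> \<open>The interval sought ends at the first switching time beyond \<open>s\<close>.
    This index is not 0 because \<open>t 0 = 0\<close> does not exceed \<open>s\<close>.\<close>
  let ?n = "LEAST n. s < t n"
  have n: "s < t ?n" using ex by (rule LeastI_ex)
  have "?n \<noteq> 0"
  proof
    assume "?n = 0" then show False using n assms by (simp add: is_switching_times_def)
  qed
  then obtain k where k: "?n = Suc k" using not0_implies_Suc by blast
  then have "\<not> s < t k" by (intro not_less_Least) simp
  then show ?thesis using that[of k] n k by simp
qed

section \<open>Growth of the Lyapunov functions and stability\<close>

lemma lyapunov_growth_on_interval:
  fixes Q :: "real^'n^'n"
  assumes der: "\<And>s. s \<in> {a..<b} \<Longrightarrow> (x has_vector_derivative A *v x s) (at s within {a..<b})"
    and lyap: "loewner_le (Q ** A + transpose A ** Q) (c *\<^sub>R Q)"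
    and s: "s \<in> {a..<b}"
  shows "x s \<bullet> (Q *v x s) \<le> exp (c * (s - a)) * (x a \<bullet> (Q *v x a))"
proof (rule gronwall_linear[OF has_real_derivative_quadratic_form[OF der] _ s])
  show "x r \<bullet> ((Q ** A + transpose A ** Q) *v x r) \<le> c * (x r \<bullet> (Q *v x r))" for r
    using loewner_le_quadratic_form[OF lyap, of "x r"] by (simp flip: scaleR_matrix_vector_assoc)
qed

text \<open>The value at \<open>b\<close> is already the one after the impulse, so the estimate
  inside the interval is carried to the left limit instead.\<close>

lemma lyapunov_growth_left_limit:
  fixes Q :: "real^'n^'n"
  assumes der: "\<And>s. s \<in> {a..<b} \<Longrightarrow> (x has_vector_derivative A *v x s) (at s within {a..<b})"
    and lyap: "loewner_le (Q ** A + transpose A ** Q) (c *\<^sub>R Q)"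
    and "a < b" and lim: "(x \<longlongrightarrow> l) (at_left b)"
  shows "l \<bullet> (Q *v l) \<le> exp (c * (b - a)) * (x a \<bullet> (Q *v x a))"
proof (rule tendsto_le[OF _ _ tendsto_quadratic_form[OF lim]])
  show "((\<lambda>s. exp (c * (s - a)) * (x a \<bullet> (Q *v x a))) \<longlongrightarrow> exp (c * (b - a)) * (x a \<bullet> (Q *v x a))) (at_left b)"
    by (intro tendsto_intros)
  show "\<forall>\<^sub>F s in at_left b. x s \<bullet> (Q *v x s) \<le> exp (c * (s - a)) * (x a \<bullet> (Q *v x a))"
    using eventually_at_left_real[OF \<open>a < b\<close>]
    by eventually_elim (rule lyapunov_growth_on_interval[OF der lyap], auto)
qed simp

theorem theorem6p6:
  fixes P :: "'p set" and A Q :: "'p \<Rightarrow> real^'n^'n"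
    and Qs :: "'q set" and I :: "'q \<Rightarrow> real^'n^'n"
    and lam mu \<tau> \<eta> :: "'p \<Rightarrow> real" and g :: "'p \<times> 'p \<Rightarrow> real" and \<gamma> :: real
    and S U :: "'p set" and \<sigma> :: "real \<Rightarrow> 'p"
  assumes "finite P"
    and "\<forall>p\<in>P. stable_matrix (A p) \<or> unstable_matrix (A p)"
    and "S = stable_indices P A" and "U = unstable_indices P A"
    and "compact (I ` Qs)"
    and "\<forall>p\<in>P. pos_def_matrix (Q p)"
    and "\<forall>p\<in>S. lam p > 0" and "\<forall>p\<in>U. mu p > 0"
    and "\<forall>p\<in>P. \<forall>q\<in>P. g (p, q) \<ge> 1"
    and "\<forall>p\<in>S. loewner_le (Q p ** A p + transpose (A p) ** Q p) ((- lam p) *\<^sub>R Q p)"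
    and "\<forall>p\<in>U. loewner_le (Q p ** A p + transpose (A p) ** Q p) (mu p *\<^sub>R Q p)"
    and "\<forall>p\<in>P. \<forall>q\<in>P. \<forall>M\<in>I ` Qs. loewner_le (transpose M ** Q p ** M) (g (q, p) *\<^sub>R Q q)"
    and "\<gamma> = Max (g ` (P \<times> P))"
    and "\<forall>p\<in>S. \<tau> p > 0" and "\<forall>p\<in>U. \<eta> p > 0"
    and "\<sigma> \<in> mode_dependent_signals P S U \<tau> \<eta>"
    and "Limsup at_top (\<lambda>t. ereal (
           - (\<Sum>p\<in>S. lam p * real (mode_count \<sigma> p t) * \<tau> p)
           + (\<Sum>p\<in>U. mu p * real (mode_count \<sigma> p t) * \<eta> p)
           + real (total_count S U \<sigma> t) * ln \<gamma>)) < 0"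
  shows "stable_under_arbitrary_impulses A Qs I \<sigma>"
proof -
  define t where "t = switching_time \<sigma>"
  define V where "V p x = x \<bullet> (Q p *v x)" for p x
  \<comment> \<open>\<open>c p\<close> is the exponential rate in mode \<open>p\<close>;
    \<open>d p\<close> will bound the logarithmic growth over a complete interval in that
    mode.\<close>
  define c where "c p = (if p \<in> S then - lam p else mu p)" for p
  define d where "d p = (if p \<in> S then - lam p * \<tau> p else mu p * \<eta> p)" for p
  define m where "m k = \<sigma> (t k)" for k
  define L where "L = ln \<gamma>"
  have sig: "switching_signal P \<sigma>"
    and dwell: "\<And>k. m k \<in> S \<Longrightarrow> t (Suc k) - t k \<ge> \<tau> (m k)"
      "\<And>k. m k \<in> U \<Longrightarrow> t (Suc k) - t k \<le> \<eta> (m k)"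
    using assms(16) by (auto simp: mode_dependent_signals_def Let_def t_def m_def)
  obtain t' where "is_switching_times \<sigma> t'" using sig by (auto simp: switching_signal_def)
  then have t: "is_switching_times \<sigma> t"
    using switching_time_eqI t_def by metis
  then have t0: "t 0 = 0" and mono: "strict_mono t" and top: "filterlim t at_top sequentially"
    by (auto simp: is_switching_times_def)
  have tnn: "t k \<ge> 0" for k using strict_mono_less_eq[OF mono, of 0 k] t0 by simp
  have tless: "t k < t (Suc k)" for k using mono by (simp add: strict_mono_less)
  have const: "\<sigma> s = m k" if "s \<in> {t k..<t (Suc k)}" for s k
    using sig that by (auto simp: switching_signal_def t_def m_def)
  have mP: "m k \<in> P" for k using sig tnn by (auto simp: switching_signal_def m_def)
  have SU: "P = S \<union> U" "S \<inter> U = {}"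
  proof -
    show "P = S \<union> U"
      using assms(2) unfolding assms(3,4) stable_indices_def unstable_indices_def by blast
    show "S \<inter> U = {}"
      unfolding assms(3,4) stable_indices_def unstable_indices_def stable_matrix_def unstable_matrix_def
      using less_asym by blast
  qed
  have fin: "finite S" "finite U" using assms(1) SU(1) by auto
  have lyap: "loewner_le (Q p ** A p + transpose (A p) ** Q p) (c p *\<^sub>R Q p)" if "p \<in> P" for p
    using that assms(10,11) SU by (auto simp: c_def)
  \<comment> \<open>A negative rate meets a lower bound on the duration, a positive rate an upper
    bound; in both cases the product is at most \<open>d\<close>.\<close>
  have cd: "c (m k) * (t (Suc k) - t k) \<le> d (m k)" for k
  proof (cases "m k \<in> S")
    case True
    then have "lam (m k) * \<tau> (m k) \<le> lam (m k) * (t (Suc k) - t k)"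
      using dwell(1) assms(7) by (intro mult_left_mono) (auto simp: less_imp_le)
    then show ?thesis using True by (simp add: c_def d_def)
  next
    case False
    then have "m k \<in> U" using mP SU by blast
    then show ?thesis using False dwell(2) assms(8)
      by (auto simp: c_def d_def less_imp_le intro!: mult_left_mono)
  qed
  \<comment> \<open>Part of an interval in a stable mode need not last for the dwell time, so only
    the factor 1 is guaranteed there; hence the maximum with 0.\<close>
  have within: "exp (c (m k) * (s - t k)) \<le> exp (max 0 (d (m k)))" if "s \<in> {t k..<t (Suc k)}" for s k
  proof -
    have "c (m k) * (s - t k) \<le> max 0 (d (m k))"
    proof (cases "c (m k) \<ge> 0")
      case True
      then have "c (m k) * (s - t k) \<le> c (m k) * (t (Suc k) - t k)"
        using that by (intro mult_left_mono) auto
      then show ?thesis using cd[of k] by linarith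
    next
      case False
      then have "c (m k) * (s - t k) \<le> 0" using that by (intro mult_nonpos_nonneg) auto
      then show ?thesis by simp
    qed
    then show ?thesis by simp
  qed
  have g_le: "g (p, q) \<le> \<gamma>" if "p \<in> P" "q \<in> P" for p q
    using that assms(1) by (auto simp: assms(13) intro!: Max_ge)
  \<comment> \<open>The mode \<open>m 0\<close> witnesses that \<open>P\<close> is nonempty, so the
    maximum \<open>\<gamma>\<close> dominates an actual \<open>g (p, p)\<close>.\<close>
  have \<gamma>1: "\<gamma> \<ge> 1" using g_le[OF mP mP, of 0 0] assms(9) mP[of 0] by force
  have expL: "exp L = \<gamma>" using \<gamma>1 by (simp add: L_def)
  obtain b B where bB: "b > 0" "B > 0" "\<And>p x. p \<in> P \<Longrightarrow> b * (norm x)\<^sup>2 \<le> V p x"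
    "\<And>p x. p \<in> P \<Longrightarrow> V p x \<le> B * (norm x)\<^sup>2"
    using pos_def_matrices_uniform_bounds[OF assms(1,6)] unfolding V_def by metis
  have Vnn: "V p x \<ge> 0" if "p \<in> P" for p x
  proof -
    have "0 \<le> b * (norm x)\<^sup>2" using bB(1) by simp
    then show ?thesis using bB(3)[OF that, of x] by linarith
  qed
  have modes: "\<sigma> (t i) \<in> S \<union> U" for i using mP[of i] by (simp add: m_def SU(1))
  obtain W where "\<And>k. - (\<Sum>p\<in>S. lam p * real (mode_count \<sigma> p (t k)) * \<tau> p)
           + (\<Sum>p\<in>U. mu p * real (mode_count \<sigma> p (t k)) * \<eta> p)
           + real (total_count S U \<sigma> (t k)) * ln \<gamma> \<le> W"
    using negative_Limsup_imp_bounded_above[OF assms(17) top] by blast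
  then have W: "(\<Sum>i<k. d (m i) + L) \<le> W" for k
    unfolding limsup_exponent_at_switching_times[OF t fin SU(2) modes] d_def m_def L_def .
  define D where "D = Max ((\<lambda>p. max 0 (d p)) ` P)"
  have D: "max 0 (d (m k)) \<le> D" for k
    unfolding D_def using assms(1) mP by (intro Max_ge) auto
  \<comment> \<open>Collects the losses: \<open>exp D\<close> for the current partial interval,
    \<open>exp W\<close> for all completed ones, and \<open>B / b\<close> for passing between norm
    and quadratic form.\<close>
  define C where "C = exp D * exp W * B / b"
  have C: "C > 0" using bB by (simp add: C_def)
  show ?thesis
    unfolding stable_under_arbitrary_impulses_def impulsive_system_stable_def
  proof (intro allI impI)
    fix \<omega> and \<epsilon> :: real
    assume \<omega>: "\<forall>k\<ge>1. \<omega> (switching_time \<sigma> k) \<in> Qs" and \<epsilon>: "\<epsilon> > 0"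
    show "\<exists>\<delta>>0. \<forall>x. impulsive_solution A I \<sigma> \<omega> x \<longrightarrow> norm (x 0) < \<delta> \<longrightarrow> (\<forall>t>0. norm (x t) < \<epsilon>)"
    proof (intro exI conjI allI impI)
      \<comment> \<open>The final estimate is \<open>norm (x s) \<le> sqrt C * norm (x 0)\<close>,
        which dictates this choice of the radius.\<close>
      show "\<epsilon> / sqrt C > 0" using \<epsilon> C by simp
      fix x and s :: real
      assume x: "impulsive_solution A I \<sigma> \<omega> x" and x0: "norm (x 0) < \<epsilon> / sqrt C" and s: "s > 0"
      \<comment> \<open>Shifts the index of \<open>impulsive_solution\<close> by one and replaces
        the signal by its constant value on the interval.\<close>
      have der: "(x has_vector_derivative A (m k) *v x r) (at r within {t k..<t (Suc k)})"
        if "r \<in> {t k..<t (Suc k)}" for r k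
        using x that const[OF that] unfolding impulsive_solution_def Let_def t_def[symmetric]
        by (metis One_nat_def Suc_le_mono diff_Suc_1 le0)
      have jump: "\<exists>l. (x \<longlongrightarrow> l) (at_left (t (Suc k))) \<and> x (t (Suc k)) = I (\<omega> (t (Suc k))) *v l" for k
        using x unfolding impulsive_solution_def Let_def t_def[symmetric] by simp
      \<comment> \<open>The chain runs backwards in time: the congruence inequality undoes the
        impulse and changes from the new form to the old one at the left limit \<open>l\<close>;
        then the flow estimate leads back to \<open>t k\<close>.\<close>
      have step: "V (m (Suc k)) (x (t (Suc k))) \<le> exp (d (m k) + L) * V (m k) (x (t k))" for k
      proof -
        obtain l where l: "(x \<longlongrightarrow> l) (at_left (t (Suc k)))" "x (t (Suc k)) = I (\<omega> (t (Suc k))) *v l"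
          using jump by blast
        let ?M = "I (\<omega> (t (Suc k)))"
        have M: "?M \<in> I ` Qs" using \<omega> by (simp add: t_def)
        have "V (m (Suc k)) (x (t (Suc k))) = l \<bullet> ((transpose ?M ** Q (m (Suc k)) ** ?M) *v l)"
          by (simp add: V_def l(2) inner_transpose_matrix_vector
              del: transpose_matrix_vector flip: matrix_vector_mul_assoc)
        also have "\<dots> \<le> l \<bullet> ((g (m k, m (Suc k)) *\<^sub>R Q (m k)) *v l)"
          using assms(12) mP M by (intro loewner_le_quadratic_form) blast
        also have "\<dots> = g (m k, m (Suc k)) * V (m k) l"
          by (simp add: V_def flip: scaleR_matrix_vector_assoc)
        also have "\<dots> \<le> \<gamma> * V (m k) l" by (intro mult_right_mono g_le mP Vnn)
        also have "V (m k) l \<le> exp (c (m k) * (t (Suc k) - t k)) * V (m k) (x (t k))"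
          unfolding V_def by (rule lyapunov_growth_left_limit[OF der lyap[OF mP] tless l(1)])
        also have "\<dots> \<le> exp (d (m k)) * V (m k) (x (t k))"
          using cd[of k] by (intro mult_right_mono Vnn mP) simp
        finally show ?thesis using \<gamma>1 by (simp add: exp_add expL mult_ac)
      qed
      have at_switch: "V (m k) (x (t k)) \<le> exp (\<Sum>i<k. d (m i) + L) * V (m 0) (x 0)" for k
      proof (induction k)
        case (Suc k)
        have "exp (d (m k) + L) * V (m k) (x (t k))
            \<le> exp (d (m k) + L) * (exp (\<Sum>i<k. d (m i) + L) * V (m 0) (x 0))"
          using Suc by (intro mult_left_mono) auto
        also have "\<dots> = exp (\<Sum>i<Suc k. d (m i) + L) * V (m 0) (x 0)"
          by (simp add: exp_add mult_ac)
        finally show ?case using step[of k] by linarith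
      qed (simp add: t0)
      obtain k where k: "s \<in> {t k..<t (Suc k)}"
        using switching_interval_exists[OF t, of s] s by auto
      have "b * (norm (x s))\<^sup>2 \<le> V (m k) (x s)" by (intro bB mP)
      also have "\<dots> \<le> exp (c (m k) * (s - t k)) * V (m k) (x (t k))"
        unfolding V_def by (rule lyapunov_growth_on_interval[OF der lyap[OF mP] k])
      \<comment> \<open>The first factor treats the current interval, the second the history up to
        \<open>t k\<close>, with the form at time 0 bounded through \<open>B\<close>.\<close>
      also have "\<dots> \<le> exp D * (exp W * (B * (norm (x 0))\<^sup>2))"
      proof (intro mult_mono)
        show "exp (c (m k) * (s - t k)) \<le> exp D"
          using within[OF k] D[of k] by (meson exp_le_cancel_iff order_trans)
        have "exp (\<Sum>i<k. d (m i) + L) * V (m 0) (x 0) \<le> exp W * (B * (norm (x 0))\<^sup>2)"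
          using W[of k] by (intro mult_mono bB mP Vnn) auto
        then show "V (m k) (x (t k)) \<le> exp W * (B * (norm (x 0))\<^sup>2)"
          using at_switch[of k] by linarith
      qed (auto intro: Vnn mP)
      finally have "(norm (x s))\<^sup>2 \<le> C * (norm (x 0))\<^sup>2"
        using bB(1) by (simp add: C_def field_simps)
      then have "norm (x s) \<le> sqrt C * norm (x 0)"
        by (metis norm_ge_zero real_le_rsqrt real_sqrt_abs abs_of_nonneg real_sqrt_mult)
      also have "\<dots> < \<epsilon>" using x0 C by (simp add: field_simps)
      finally show "norm (x s) < \<epsilon>" .
    qed
  qed
qed

end
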